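(* Let $m,n$ be positive integers. For each $i\in\{1,\dots,m\}$ let $h_i:\mathbb{R}^n\to\mathbb{R}\cup\{\infty\}$ be Legendre and positively homogeneous of degree $p_i\in(1,\infty)$ over $\operatorname{int}(\operatorname{dom} h_i)$. Suppose that $p_1<p_2\le\dots\le p_{m-1}<p_m$. Then $h:=\sum_{i=1}^m h_i$ is a Legendre function and $$\alpha(h)\in\left[\min_{i\in\{1,\dots,m\}}\{\alpha(h_i)\},\ \min\{\alpha(h_1),\alpha(h_m)\}\right].$$
   Context: The condition $p_1<p_2\le\dots\le p_{m-1}<p_m$ means that the sequence is nondecreasing with its first inequality and its last inequality strict (for $m=2$ it reads $p_1<p_2$). A function $f$ is positively homogeneous of degree $p>0$ over a set $S\subset\mathbb{R}^n$ if $f(\lambda x)=\lambda^p f(x)$ for all $\lambda>0$ and all $x\in S$ such that $\lambda x\in S$. For $h:\mathbb{R}^n\to\mathbb{R}\cup\{\infty\}$, $\operatorname{dom} h := \{x\in\mathbb{R}^n \mid h(x)<\infty\}$. A proper convex function $h$ is essentially smooth if (i) $S:=\operatorname{int}(\operatorname{dom} h)$ is non-empty, (ii) $h$ is differentiable on $S$, and (iii) for every sequence $(x^{(i)})$ in $S$ converging to a point of the boundary of $S$, $\lim_{i\to\infty}\|\nabla h(x^{(i)})\|_2=\infty$. A function $h$ is a Legendre function if it is proper, closed (lower semicontinuous) and convex, strictly convex on $\operatorname{int}(\operatorname{dom} h)$, and essentially smooth. The Bregman distance is $D_h(x,y) := h(x)-h(y)-\langle\nabla h(y),x-y\rangle$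 if $y\in\operatorname{int}(\operatorname{dom} h)$ and $D_h(x,y):=\infty$ otherwise. The symmetry coefficient of a Legendre function $h$ is $$\alpha(h) := \inf\left\{ \frac{D_h(x,y)}{D_h(y,x)} \;\middle|\; x,y\in\operatorname{int}(\operatorname{dom} h),\ x\neq y\right\}.$$ *)

theory Defs
  imports "HOL-Analysis.Analysis"
begin

text \<open>
  A function into $\mathbb{R}\cup\{\infty\}$ is modelled as an \<^typ>\<open>ereal\<close>-valued function that
  never takes the value \<open>-\<infinity>\<close>; the latter is part of \<open>proper_fun\<close>.
\<close>

definition eff_dom :: "('a \<Rightarrow> ereal) \<Rightarrow> 'a set" where
  "eff_dom h = {x. h x < \<infinity>}"

definition proper_fun :: "('a \<Rightarrow> ereal) \<Rightarrow> bool" where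
  "proper_fun h \<longleftrightarrow> (\<forall>x. h x \<noteq> -\<infinity>) \<and> eff_dom h \<noteq> {}"

text \<open>
  The weights are strictly positive, so the \<^typ>\<open>ereal\<close> convention \<open>0 * \<infinity> = 0\<close> plays no role.
\<close>

definition convex_fun :: "('a::real_vector \<Rightarrow> ereal) \<Rightarrow> bool" where
  "convex_fun h \<longleftrightarrow>
    (\<forall>x y u v. u > 0 \<longrightarrow> v > 0 \<longrightarrow> u + v = 1 \<longrightarrow>
      h (u *\<^sub>R x + v *\<^sub>R y) \<le> ereal u * h x + ereal v * h y)"

definition strictly_convex_fun_on :: "'a::real_vector set \<Rightarrow> ('a \<Rightarrow> ereal) \<Rightarrow> bool" where
  "strictly_convex_fun_on S h \<longleftrightarrow>
    (\<forall>x\<in>S. \<forall>y\<in>S. \<forall>u v. x \<noteq> y \<longrightarrow> u > 0 \<longrightarrow> v > 0 \<longrightarrow> u + v = 1 \<longrightarrow>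
      h (u *\<^sub>R x + v *\<^sub>R y) < ereal u * h x + ereal v * h y)"

definition lower_semicontinuous :: "('a::topological_space \<Rightarrow> ereal) \<Rightarrow> bool" where
  "lower_semicontinuous h \<longleftrightarrow> (\<forall>x. h x \<le> Liminf (at x) h)"

text \<open>
  At points of \<open>interior (eff_dom h)\<close> a proper \<open>h\<close> is finite in a neighbourhood, so that
  composing with \<^const>\<open>real_of_ereal\<close> does not affect differentiability or the gradient there;
  both notions are only used at such points.
\<close>

definition gradient :: "('a::euclidean_space \<Rightarrow> ereal) \<Rightarrow> 'a \<Rightarrow> 'a" where
  "gradient h x = (THE g. GDERIV (\<lambda>z. real_of_ereal (h z)) x :> g)"

definition essentially_smooth :: "('a::euclidean_space \<Rightarrow> ereal) \<Rightarrow> bool" where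
  "essentially_smooth h \<longleftrightarrow>
    interior (eff_dom h) \<noteq> {} \<and>
    (\<forall>x\<in>interior (eff_dom h). (\<lambda>z. real_of_ereal (h z)) differentiable (at x)) \<and>
    (\<forall>X x. (\<forall>i. X i \<in> interior (eff_dom h)) \<longrightarrow> X \<longlonglongrightarrow> x \<longrightarrow>
       x \<in> frontier (interior (eff_dom h)) \<longrightarrow>
       filterlim (\<lambda>i. norm (gradient h (X i))) at_top sequentially)"

definition legendre :: "('a::euclidean_space \<Rightarrow> ereal) \<Rightarrow> bool" where
  "legendre h \<longleftrightarrow>
    proper_fun h \<and> lower_semicontinuous h \<and> convex_fun h \<and>
    strictly_convex_fun_on (interior (eff_dom h)) h \<and> essentially_smooth h"

definition bregman :: "('a::euclidean_space \<Rightarrow> ereal) \<Rightarrow> 'a \<Rightarrow> 'a \<Rightarrow> ereal" where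
  "bregman h x y =
    (if y \<in> interior (eff_dom h) then h x - h y - ereal (gradient h y \<bullet> (x - y)) else \<infinity>)"

text \<open>
  For a Legendre function all quotients below are quotients of positive real numbers.
\<close>

definition symmetry_coeff :: "('a::euclidean_space \<Rightarrow> ereal) \<Rightarrow> ereal" where
  "symmetry_coeff h =
    Inf {bregman h x y / bregman h y x | x y.
      x \<in> interior (eff_dom h) \<and> y \<in> interior (eff_dom h) \<and> x \<noteq> y}"

definition pos_homogeneous_on ::
    "'a::real_vector set \<Rightarrow> real \<Rightarrow> ('a \<Rightarrow> ereal) \<Rightarrow> bool" where
  "pos_homogeneous_on S p f \<longleftrightarrow>
    p > 0 \<and> (\<forall>c>0. \<forall>x\<in>S. c *\<^sub>R x \<in> S \<longrightarrow> f (c *\<^sub>R x) = ereal (c powr p) * f x)"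

end

theory Submission
  imports Defs
begin

text \<open>
  The gradient of a function that is homogeneous of degree \<open>p > 1\<close> is homogeneous of degree
  \<open>p - 1 > 0\<close>, so it stays bounded along a ray up to any finite end point, the origin included.
  Essential smoothness therefore forbids a ray from reaching the boundary of the domain, and a
  homogeneous Legendre function is finite everywhere (\<open>homogeneous_legendre_finite\<close>). All the
  summands, and hence their sum, are thus differentiable and strictly convex on the whole space,
  which makes the sum Legendre; and the Bregman distances are positive real numbers that add up
  and scale: moving from \<open>(x, y)\<close> to \<open>(t x, t y)\<close> multiplies the distance of a summand of
  degree \<open>p\<close> by \<open>t\<^sup>p\<close>.

  A ratio of sums with positive denominators is at least the smallest of the ratios of the terms
  (\<open>ratio_of_sums_ge_some_ratio\<close>), which gives the lower bound on the symmetry coefficient. For the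
  upper bound, consider the ratio of the sums at \<open>(t x, t y)\<close>. As \<open>t\<close> tends to \<open>0\<close> the
  term with the strictly smallest exponent dominates, and as \<open>t\<close> tends to infinity the one
  with the strictly largest does (\<open>symmetry_coeff_sum_le_dominant\<close>). The limit is the ratio
  for this one summand at the arbitrary pair \<open>(x, y)\<close>.
\<close>

section \<open>Gradients of homogeneous functions\<close>

lemma GDERIV_unique:
  fixes f :: "'a::euclidean_space \<Rightarrow> real"
  assumes "GDERIV f x :> a" and "GDERIV f x :> b"
  shows "a = b"
proof -
  have "(\<lambda>v. v \<bullet> a) = (\<lambda>v. v \<bullet> b)"
    using assms unfolding gderiv_def by (rule has_derivative_unique)
  then have "\<forall>v. v \<bullet> a = v \<bullet> b" by metis
  then show ?thesis by (simp add: vector_eq_ldot)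
qed

lemma differentiable_imp_GDERIV:
  fixes f :: "'a::euclidean_space \<Rightarrow> real"
  assumes "f differentiable (at x)"
  shows "\<exists>g. GDERIV f x :> g"
proof -
  obtain f' where f': "(f has_derivative f') (at x)"
    using assms unfolding differentiable_def by blast
  then have lin: "linear f'"
    using has_derivative_linear by blast
  have "f' = (\<lambda>v. v \<bullet> adjoint f' 1)"
    using adjoint_works[OF lin, of _ 1] by (simp add: fun_eq_iff inner_commute)
  then show ?thesis
    using f' unfolding gderiv_def by metis
qed

lemma gradient_eqI:
  assumes "GDERIV (\<lambda>z. real_of_ereal (h z)) x :> g"
  shows "gradient h x = g"
  unfolding gradient_def using assms GDERIV_unique by blast

lemma GDERIV_gradient:
  assumes "(\<lambda>z. real_of_ereal (h z)) differentiable (at x)"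
  shows "GDERIV (\<lambda>z. real_of_ereal (h z)) x :> gradient h x"
  using differentiable_imp_GDERIV[OF assms] gradient_eqI by metis

text \<open>
  Differentiating \<open>f (c z) = c\<^sup>p f z\<close> in \<open>z\<close> gives \<open>c \<nabla>f (c x) = c\<^sup>p \<nabla>f x\<close>. The identity
  is only asked for near \<open>x\<close>, because homogeneity is first known inside the domain only.
\<close>
lemma GDERIV_homogeneous:
  fixes f :: "'a::euclidean_space \<Rightarrow> real"
  assumes c: "c > 0"
    and hom: "\<forall>\<^sub>F z in nhds x. f (c *\<^sub>R z) = c powr p * f z"
    and g: "GDERIV f x :> g" and g': "GDERIV f (c *\<^sub>R x) :> g'"
  shows "g' = c powr (p - 1) *\<^sub>R g"
proof -
  have "((\<lambda>z. f (c *\<^sub>R z)) has_derivative (\<lambda>v. (c *\<^sub>R v) \<bullet> g')) (at x)"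
  proof (rule has_derivative_compose[of "\<lambda>z. c *\<^sub>R z" "\<lambda>v. c *\<^sub>R v" x UNIV f "\<lambda>v. v \<bullet> g'"])
    show "((\<lambda>z. c *\<^sub>R z) has_derivative (\<lambda>v. c *\<^sub>R v)) (at x)"
      by (intro derivative_eq_intros) auto
  qed (use g' in \<open>simp add: gderiv_def\<close>)
  moreover have "((\<lambda>z. f (c *\<^sub>R z)) has_derivative (\<lambda>v. c powr p * (v \<bullet> g))) (at x)"
  proof -
    have "((\<lambda>z. c powr p * f z) has_derivative (\<lambda>v. c powr p * (v \<bullet> g))) (at x)"
      using g unfolding gderiv_def by (rule has_derivative_mult_right)
    moreover have "\<forall>\<^sub>F z in at x. c powr p * f z = f (c *\<^sub>R z)"
      using filter_leD[OF at_within_le_nhds hom] by (rule eventually_mono) simp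
    ultimately show ?thesis
      by (rule has_derivative_transform_eventually) (simp_all add: eventually_nhds_x_imp_x[OF hom])
  qed
  ultimately have "(\<lambda>v. (c *\<^sub>R v) \<bullet> g') = (\<lambda>v. c powr p * (v \<bullet> g))"
    by (rule has_derivative_unique)
  then have eq: "(c *\<^sub>R v) \<bullet> g' = c powr p * (v \<bullet> g)" for v
    by metis
  have "v \<bullet> g' = v \<bullet> (c powr (p - 1) *\<^sub>R g)" for v
    using eq[of v] c by (simp add: powr_diff field_simps)
  then show ?thesis
    by (metis vector_eq_ldot)
qed

section \<open>Homogeneous Legendre functions are finite\<close>

lemma convex_eff_dom:
  assumes "convex_fun h"
  shows "convex (eff_dom h)"
proof (rule convexI)
  fix x y and u v :: real
  assume x: "x \<in> eff_dom h" and y: "y \<in> eff_dom h" and uv: "0 \<le> u" "0 \<le> v" "u + v = 1"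
  show "u *\<^sub>R x + v *\<^sub>R y \<in> eff_dom h"
  proof (cases "u = 0 \<or> v = 0")
    case True
    then show ?thesis using uv x y by auto
  next
    case False
    then have "h (u *\<^sub>R x + v *\<^sub>R y) \<le> ereal u * h x + ereal v * h y"
      using assms uv unfolding convex_fun_def by simp
    also have "\<dots> < \<infinity>"
      using x y uv False unfolding eff_dom_def
      by (cases "h x"; cases "h y") auto
    finally show ?thesis by (simp add: eff_dom_def)
  qed
qed

lemma legendre_gradient_scaleR:
  assumes leg: "legendre h" and hom: "pos_homogeneous_on (interior (eff_dom h)) p h"
    and x: "x \<in> interior (eff_dom h)" and c: "c > 0"
    and cx: "c *\<^sub>R x \<in> interior (eff_dom h)"
  shows "gradient h (c *\<^sub>R x) = c powr (p - 1) *\<^sub>R gradient h x"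
proof (rule GDERIV_homogeneous[where f = "\<lambda>z. real_of_ereal (h z)"])
  let ?S = "interior (eff_dom h)"
  have "open ((\<lambda>z. c *\<^sub>R z) -` ?S)"
    by (intro open_vimage continuous_intros) auto
  then have "\<forall>\<^sub>F z in nhds x. z \<in> ?S \<and> c *\<^sub>R z \<in> ?S"
    using x cx by (intro eventually_conj) (auto simp: eventually_nhds intro: exI[of _ ?S])
  then show "\<forall>\<^sub>F z in nhds x. real_of_ereal (h (c *\<^sub>R z)) = c powr p * real_of_ereal (h z)"
    by (rule eventually_mono) (use hom c in \<open>auto simp: pos_homogeneous_on_def\<close>)
  show "GDERIV (\<lambda>z. real_of_ereal (h z)) x :> gradient h x"
    "GDERIV (\<lambda>z. real_of_ereal (h z)) (c *\<^sub>R x) :> gradient h (c *\<^sub>R x)"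
    using leg x cx unfolding legendre_def essentially_smooth_def
    by (auto intro!: GDERIV_gradient)
qed (rule c)

text \<open>
  Approach a hypothetical frontier point \<open>t x\<close> along the ray from inside: the gradient norms
  converge to \<open>t\<^sup>p\<^sup>-\<^sup>1 \<parallel>\<nabla>h x\<parallel>\<close>, whereas essential smoothness makes them diverge. Degree
  greater than one is what covers \<open>t = 0\<close>.
\<close>
lemma homogeneous_legendre_ray_avoids_frontier:
  assumes leg: "legendre h" and hom: "pos_homogeneous_on (interior (eff_dom h)) p h"
    and p: "p > 1" and x: "x \<in> interior (eff_dom h)" and t: "t \<ge> 0"
  shows "t *\<^sub>R x \<notin> frontier (interior (eff_dom h))"
proof
  let ?S = "interior (eff_dom h)"
  assume fr: "t *\<^sub>R x \<in> frontier ?S"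
  \<comment> \<open>Convex combinations of \<open>t\<close> and \<open>1\<close>, so that \<open>c k x\<close> lies strictly between \<open>t x\<close> and \<open>x\<close>.\<close>
  define c where "c k = (1 - inverse (real (Suc (Suc k)))) * t + inverse (real (Suc (Suc k)))"
    for k
  have "(\<lambda>k. inverse (real (Suc (Suc k)))) \<longlonglongrightarrow> 0"
    using LIMSEQ_Suc[OF LIMSEQ_inverse_real_of_nat] .
  then have "c \<longlonglongrightarrow> (1 - 0) * t + 0"
    unfolding c_def by (intro tendsto_intros)
  then have lim: "c \<longlonglongrightarrow> t" by simp
  have frac: "inverse (real (Suc (Suc k))) < 1" for k
    by (simp add: divide_simps)
  then have cpos: "c k > 0" for k
    unfolding c_def using t by (intro add_nonneg_pos mult_nonneg_nonneg) (auto simp: less_imp_le)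
  have "t *\<^sub>R x \<notin> ?S"
    using fr by (simp add: frontier_def)
  then have ne: "x \<noteq> t *\<^sub>R x"
    using x by metis
  have "convex (eff_dom h)"
    using leg convex_eff_dom unfolding legendre_def by blast
  then have "convex ?S"
    by (rule convex_interior)
  then have seg: "open_segment x (t *\<^sub>R x) \<subseteq> interior ?S"
    using x fr by (intro in_interior_closure_convex_segment) (auto simp: frontier_def)
  have mem: "c k *\<^sub>R x \<in> ?S" for k
  proof -
    have "c k *\<^sub>R x \<in> open_segment x (t *\<^sub>R x)"
      unfolding in_segment
      using ne frac[of k]
      by (intro conjI exI[of _ "1 - inverse (real (Suc (Suc k)))"])
        (auto simp: c_def algebra_simps)
    then show ?thesis using seg by auto
  qed
  have "norm (gradient h (c k *\<^sub>R x)) = c k powr (p - 1) * norm (gradient h x)" for k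
    using legendre_gradient_scaleR[OF leg hom x cpos mem] cpos[of k] by simp
  moreover have "(\<lambda>k. c k powr (p - 1) * norm (gradient h x))
      \<longlonglongrightarrow> t powr (p - 1) * norm (gradient h x)"
    using p cpos
    by (intro tendsto_mult tendsto_const tendsto_powr' lim) (auto simp: less_imp_le)
  ultimately have "(\<lambda>k. norm (gradient h (c k *\<^sub>R x)))
      \<longlonglongrightarrow> t powr (p - 1) * norm (gradient h x)"
    by simp
  moreover have "filterlim (\<lambda>k. norm (gradient h (c k *\<^sub>R x))) at_top sequentially"
  proof -
    have "(\<lambda>k. c k *\<^sub>R x) \<longlonglongrightarrow> t *\<^sub>R x"
      using lim by (intro tendsto_intros)
    moreover have "\<forall>X z. (\<forall>k. X k \<in> ?S) \<longrightarrow> X \<longlonglongrightarrow> z \<longrightarrow> z \<in> frontier ?S \<longrightarrow>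
        filterlim (\<lambda>k. norm (gradient h (X k))) at_top sequentially"
      using leg unfolding legendre_def essentially_smooth_def by blast
    ultimately show ?thesis
      using mem fr by simp
  qed
  then have "filterlim (\<lambda>k. norm (gradient h (c k *\<^sub>R x))) at_infinity sequentially"
    by (rule filterlim_at_top_imp_at_infinity)
  ultimately show False
    by (rule not_tendsto_and_filterlim_at_infinity[OF sequentially_bot])
qed

text \<open>
  A ray from a point of the interior is connected and misses the frontier, so it stays inside,
  its end point \<open>0\<close> included. The interior is then a neighbourhood of \<open>0\<close> closed under scaling.
\<close>
lemma homogeneous_legendre_finite:
  assumes leg: "legendre h" and hom: "pos_homogeneous_on (interior (eff_dom h)) p h"
    and p: "p > 1"
  shows "interior (eff_dom h) = UNIV"
proof -
  let ?S = "interior (eff_dom h)"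
  have ray: "t *\<^sub>R x \<in> ?S" if x: "x \<in> ?S" and t: "t \<ge> 0" for x t
  proof (rule ccontr)
    assume nin: "t *\<^sub>R x \<notin> ?S"
    have "connected ((\<lambda>s. s *\<^sub>R x) ` {0..})"
      by (intro connected_continuous_image continuous_intros) auto
    moreover have "x \<in> (\<lambda>s. s *\<^sub>R x) ` {0..}"
      by (rule image_eqI[of _ _ 1]) auto
    ultimately have "(\<lambda>s. s *\<^sub>R x) ` {0..} \<inter> frontier ?S \<noteq> {}"
      using x t nin by (intro connected_Int_frontier) auto
    then show False
      using homogeneous_legendre_ray_avoids_frontier[OF leg hom p x] by auto
  qed
  obtain x where "x \<in> ?S"
    using leg unfolding legendre_def essentially_smooth_def by blast
  then have "0 \<in> ?S"
    using ray[of x 0] by simp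
  then obtain e where e: "e > 0" "ball 0 e \<subseteq> ?S"
    using open_contains_ball open_interior by metis
  have "y \<in> ?S" for y
  proof -
    define s where "s = e / (1 + norm y)"
    have s: "s > 0"
      unfolding s_def using e by (simp add: add_pos_nonneg)
    have "norm (s *\<^sub>R y) < e"
      unfolding s_def using e by (simp add: field_simps add_pos_nonneg)
    then have "s *\<^sub>R y \<in> ?S"
      using e by auto
    then show ?thesis
      using ray[of "s *\<^sub>R y" "1 / s"] s by simp
  qed
  then show ?thesis by auto
qed

section \<open>Strictly convex differentiable functions on the whole space\<close>

definition strictly_convex :: "('a::real_vector \<Rightarrow> real) \<Rightarrow> bool" where
  "strictly_convex f \<longleftrightarrow>
    (\<forall>x y u v. x \<noteq> y \<longrightarrow> u > 0 \<longrightarrow> v > 0 \<longrightarrow> u + v = 1 \<longrightarrow>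
      f (u *\<^sub>R x + v *\<^sub>R y) < u * f x + v * f y)"

text \<open>
  The real-valued Bregman distance. The derivative enters as a linear map and not through its
  representing gradient vector, so that additivity in \<open>f\<close> is the sum rule for derivatives.
\<close>
definition breg :: "('a::real_normed_vector \<Rightarrow> real) \<Rightarrow> 'a \<Rightarrow> 'a \<Rightarrow> real" where
  "breg f x y = f x - f y - frechet_derivative f (at y) (x - y)"

lemma homogeneous_legendre_real:
  fixes h :: "'a::euclidean_space \<Rightarrow> ereal"
  assumes leg: "legendre h" and hom: "pos_homogeneous_on (interior (eff_dom h)) p h"
    and p: "p > 1"
  obtains f where "h = (\<lambda>x. ereal (f x))" "f differentiable_on UNIV" "strictly_convex f"
    "\<And>c x. c > 0 \<Longrightarrow> f (c *\<^sub>R x) = c powr p * f x"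
proof
  have int: "interior (eff_dom h) = UNIV"
    by (rule homogeneous_legendre_finite[OF assms])
  have eq: "h x = ereal (real_of_ereal (h x))" for x
  proof -
    have "h x < \<infinity>"
      using int interior_subset[of "eff_dom h"] by (auto simp: eff_dom_def)
    moreover have "h x \<noteq> - \<infinity>"
      using leg by (simp add: legendre_def proper_fun_def)
    ultimately show ?thesis
      by (cases "h x") auto
  qed
  then show "h = (\<lambda>x. ereal (real_of_ereal (h x)))"
    by (rule ext)
  show "(\<lambda>x. real_of_ereal (h x)) differentiable_on UNIV"
    using leg int by (auto simp: legendre_def essentially_smooth_def differentiable_on_def)
  show "strictly_convex (\<lambda>x. real_of_ereal (h x))"
    unfolding strictly_convex_def
  proof (intro allI impI)
    fix x y :: 'a and u v :: real
    assume "x \<noteq> y" "u > 0" "v > 0" "u + v = 1"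
    then have "h (u *\<^sub>R x + v *\<^sub>R y) < ereal u * h x + ereal v * h y"
      using leg int by (simp add: legendre_def strictly_convex_fun_on_def)
    then have "ereal (real_of_ereal (h (u *\<^sub>R x + v *\<^sub>R y)))
        < ereal u * ereal (real_of_ereal (h x)) + ereal v * ereal (real_of_ereal (h y))"
      by (simp only: eq[symmetric])
    then show "real_of_ereal (h (u *\<^sub>R x + v *\<^sub>R y))
        < u * real_of_ereal (h x) + v * real_of_ereal (h y)"
      by simp
  qed
  show "real_of_ereal (h (c *\<^sub>R x)) = c powr p * real_of_ereal (h x)" if "c > 0" for c x
    using hom int that by (simp add: pos_homogeneous_on_def)
qed

lemma interior_eff_dom_real [simp]: "interior (eff_dom (\<lambda>x. ereal (f x))) = UNIV"
  by (simp add: eff_dom_def)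

lemma strictly_convex_imp_convex_ineq:
  assumes "strictly_convex f" "u > 0" "v > 0" "u + v = 1"
  shows "f (u *\<^sub>R x + v *\<^sub>R y) \<le> u * f x + v * f y"
proof (cases "x = y")
  case True
  then show ?thesis
    using assms(4) by (simp flip: scaleR_add_left distrib_right)
next
  case False
  then show ?thesis
    using assms unfolding strictly_convex_def by (simp add: less_imp_le)
qed

text \<open>
  The blow-up condition at the boundary is vacuous, because the whole space has empty frontier.
\<close>
lemma legendre_real:
  fixes f :: "'a::euclidean_space \<Rightarrow> real"
  assumes diff: "f differentiable_on UNIV" and conv: "strictly_convex f"
  shows "legendre (\<lambda>x. ereal (f x))"
proof -
  have "isCont f x" for x
    using differentiable_imp_continuous_on[OF diff] by (simp add: continuous_on_eq_continuous_at)
  then have "((\<lambda>z. ereal (f z)) \<longlongrightarrow> ereal (f x)) (at x)" for x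
    by (simp add: isCont_def)
  then have "Liminf (at x) (\<lambda>z. ereal (f z)) = ereal (f x)" for x
    by (intro lim_imp_Liminf) auto
  then show ?thesis
    using diff conv strictly_convex_imp_convex_ineq[OF conv]
    by (auto simp: legendre_def proper_fun_def lower_semicontinuous_def convex_fun_def
        strictly_convex_fun_on_def strictly_convex_def essentially_smooth_def eff_dom_def
        differentiable_on_def)
qed

lemma bregman_real:
  fixes f :: "'a::euclidean_space \<Rightarrow> real"
  assumes "f differentiable_on UNIV"
  shows "bregman (\<lambda>x. ereal (f x)) x y = ereal (breg f x y)"
proof -
  have "GDERIV f y :> gradient (\<lambda>x. ereal (f x)) y"
    using GDERIV_gradient[of "\<lambda>x. ereal (f x)" y] assms by (simp add: differentiable_on_def)
  then have "frechet_derivative f (at y) = (\<lambda>v. v \<bullet> gradient (\<lambda>x. ereal (f x)) y)"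
    unfolding gderiv_def by (metis frechet_derivative_at)
  then show ?thesis
    by (simp add: bregman_def breg_def inner_commute)
qed

text \<open>
  The slope of the tangent at \<open>y\<close> in direction \<open>x - y\<close> is a limit of difference quotients over
  shorter and shorter steps, each of which is at most the slope of the full chord.
\<close>
lemma convex_above_tangent:
  fixes f :: "'a::real_normed_vector \<Rightarrow> real"
  assumes diff: "f differentiable (at y)"
    and conv: "\<And>u v. u > 0 \<Longrightarrow> v > 0 \<Longrightarrow> u + v = 1 \<Longrightarrow>
      f (u *\<^sub>R x + v *\<^sub>R y) \<le> u * f x + v * f y"
  shows "breg f x y \<ge> 0"
proof -
  let ?\<phi> = "\<lambda>t. f (y + t *\<^sub>R (x - y))"
  let ?d = "frechet_derivative f (at y)"
  have f': "(f has_derivative ?d) (at (y + 0 *\<^sub>R (x - y)))"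
    using diff by (simp add: frechet_derivative_works)
  have "(?\<phi> has_derivative (\<lambda>t. ?d (t *\<^sub>R (x - y)))) (at 0)"
    by (rule has_derivative_compose[of "\<lambda>t. y + t *\<^sub>R (x - y)" "\<lambda>t. t *\<^sub>R (x - y)" 0 UNIV f ?d,
          OF _ f'])
      (auto intro!: derivative_eq_intros)
  moreover have "?d (t *\<^sub>R (x - y)) = ?d (x - y) * t" for t
    using linear_frechet_derivative[OF diff] by (simp add: linear_cmul)
  ultimately have "(?\<phi> has_real_derivative ?d (x - y)) (at 0)"
    by (simp add: has_field_derivative_def)
  then have lim: "((\<lambda>t. (?\<phi> t - ?\<phi> 0) / t) \<longlongrightarrow> ?d (x - y)) (at_right 0)"
    by (auto simp: has_field_derivative_iff intro: filterlim_mono at_le)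
  have "\<forall>\<^sub>F t in at_right (0::real). t \<in> {0<..<1}"
    by (rule eventually_at_right_real) simp
  then have "\<forall>\<^sub>F t in at_right 0. (?\<phi> t - ?\<phi> 0) / t \<le> f x - f y"
  proof (rule eventually_mono)
    fix t :: real assume t: "t \<in> {0<..<1}"
    have "y + t *\<^sub>R (x - y) = t *\<^sub>R x + (1 - t) *\<^sub>R y"
      by (simp add: algebra_simps)
    then have "?\<phi> t \<le> t * f x + (1 - t) * f y"
      using conv[of t "1 - t"] t by simp
    then have "?\<phi> t - ?\<phi> 0 \<le> (f x - f y) * t"
      by (simp add: algebra_simps)
    then show "(?\<phi> t - ?\<phi> 0) / t \<le> f x - f y"
      using t by (simp add: divide_le_eq)
  qed
  then have "?d (x - y) \<le> f x - f y"
    by (rule tendsto_upperbound[OF lim]) simp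
  then show ?thesis
    by (simp add: breg_def)
qed

text \<open>
  At the midpoint \<open>z\<close> of \<open>x\<close> and \<open>y\<close> the graph is on or above the tangent at \<open>y\<close>, and strictly
  below the chord. Hence at \<open>x\<close> the chord is strictly above the tangent.
\<close>
lemma breg_pos:
  fixes f :: "'a::real_normed_vector \<Rightarrow> real"
  assumes diff: "f differentiable_on UNIV" and conv: "strictly_convex f" and "x \<noteq> y"
  shows "breg f x y > 0"
proof -
  let ?z = "(1/2) *\<^sub>R x + (1/2) *\<^sub>R y"
  let ?d = "frechet_derivative f (at y)"
  have d: "f differentiable (at y)"
    using diff by (simp add: differentiable_on_def)
  have "breg f ?z y \<ge> 0"
    using strictly_convex_imp_convex_ineq[OF conv] by (intro convex_above_tangent d) auto
  moreover have "?z - y = (1/2) *\<^sub>R (x - y)"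
    by (simp add: algebra_simps flip: scaleR_add_left)
  then have "?d (?z - y) = ?d (x - y) / 2"
    using linear_frechet_derivative[OF d] by (simp add: linear_cmul)
  moreover have "f ?z < (1/2) * f x + (1/2) * f y"
    using conv[unfolded strictly_convex_def, rule_format, of x y "1/2" "1/2"] \<open>x \<noteq> y\<close> by simp
  ultimately show ?thesis
    by (simp add: breg_def)
qed

lemma breg_sum:
  assumes "\<And>i. i \<in> I \<Longrightarrow> f i differentiable_on UNIV"
  shows "breg (\<lambda>x. \<Sum>i\<in>I. f i x) x y = (\<Sum>i\<in>I. breg (f i) x y)"
proof -
  have "((\<lambda>x. \<Sum>i\<in>I. f i x) has_derivative
      (\<lambda>v. \<Sum>i\<in>I. frechet_derivative (f i) (at y) v)) (at y)"
    using assms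
    by (intro has_derivative_sum) (simp add: differentiable_on_def frechet_derivative_works)
  then have "frechet_derivative (\<lambda>x. \<Sum>i\<in>I. f i x) (at y)
      = (\<lambda>v. \<Sum>i\<in>I. frechet_derivative (f i) (at y) v)"
    by (metis frechet_derivative_at)
  then show ?thesis
    by (simp add: breg_def sum_subtractf)
qed

lemma breg_homogeneous:
  fixes f :: "'a::euclidean_space \<Rightarrow> real"
  assumes diff: "f differentiable_on UNIV" and c: "c > 0"
    and hom: "\<And>c x. c > 0 \<Longrightarrow> f (c *\<^sub>R x) = c powr p * f x"
  shows "breg f (c *\<^sub>R x) (c *\<^sub>R y) = c powr p * breg f x y"
proof -
  have d: "f differentiable (at z)" for z
    using diff by (simp add: differentiable_on_def)
  obtain g g' where g: "GDERIV f y :> g" and g': "GDERIV f (c *\<^sub>R y) :> g'"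
    using differentiable_imp_GDERIV d by metis
  have eq: "g' = c powr (p - 1) *\<^sub>R g"
    using GDERIV_homogeneous[OF c _ g g', of p] hom[OF c] by simp
  have "frechet_derivative f (at y) = (\<lambda>v. v \<bullet> g)"
    "frechet_derivative f (at (c *\<^sub>R y)) = (\<lambda>v. v \<bullet> g')"
    using g g' unfolding gderiv_def by (metis frechet_derivative_at)+
  then show ?thesis
    using c by (simp add: breg_def hom eq powr_diff field_simps inner_diff_left)
qed

lemma differentiable_on_strictly_convex_sum:
  fixes f :: "'i \<Rightarrow> 'a::real_normed_vector \<Rightarrow> real"
  assumes "finite I" "I \<noteq> {}"
    and diff: "\<And>i. i \<in> I \<Longrightarrow> f i differentiable_on UNIV"
    and conv: "\<And>i. i \<in> I \<Longrightarrow> strictly_convex (f i)"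
  shows "(\<lambda>x. \<Sum>i\<in>I. f i x) differentiable_on UNIV" "strictly_convex (\<lambda>x. \<Sum>i\<in>I. f i x)"
proof -
  show "(\<lambda>x. \<Sum>i\<in>I. f i x) differentiable_on UNIV"
    using diff assms(1) by (auto simp: differentiable_on_def intro!: differentiable_sum)
  show "strictly_convex (\<lambda>x. \<Sum>i\<in>I. f i x)"
    unfolding strictly_convex_def
  proof (intro allI impI)
    fix x y :: 'a and u v :: real
    assume "x \<noteq> y" "u > 0" "v > 0" "u + v = 1"
    then have "(\<Sum>i\<in>I. f i (u *\<^sub>R x + v *\<^sub>R y)) < (\<Sum>i\<in>I. u * f i x + v * f i y)"
      using assms(1,2) conv by (intro sum_strict_mono) (auto simp: strictly_convex_def)
    then show "(\<Sum>i\<in>I. f i (u *\<^sub>R x + v *\<^sub>R y)) < u * (\<Sum>i\<in>I. f i x) + v * (\<Sum>i\<in>I. f i y)"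
      by (simp add: sum.distrib sum_distrib_left)
  qed
qed

section \<open>Symmetry coefficients of sums\<close>

lemma symmetry_coeff_real:
  fixes f :: "'a::euclidean_space \<Rightarrow> real"
  assumes "f differentiable_on UNIV" "strictly_convex f"
  shows "symmetry_coeff (\<lambda>x. ereal (f x)) = Inf {ereal (breg f x y / breg f y x) | x y. x \<noteq> y}"
proof -
  have "bregman (\<lambda>x. ereal (f x)) x y / bregman (\<lambda>x. ereal (f x)) y x
      = ereal (breg f x y / breg f y x)" if "x \<noteq> y" for x y
    using breg_pos[OF assms, of y x] that by (simp add: bregman_real assms)
  then have "{bregman (\<lambda>x. ereal (f x)) x y / bregman (\<lambda>x. ereal (f x)) y x | x y. x \<noteq> y}
      = {ereal (breg f x y / breg f y x) | x y. x \<noteq> y}"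
    by (intro Collect_cong) metis
  then show ?thesis
    by (simp add: symmetry_coeff_def)
qed

lemma symmetry_coeff_real_le:
  fixes f :: "'a::euclidean_space \<Rightarrow> real"
  assumes "f differentiable_on UNIV" "strictly_convex f" "x \<noteq> y"
  shows "symmetry_coeff (\<lambda>x. ereal (f x)) \<le> ereal (breg f x y / breg f y x)"
  unfolding symmetry_coeff_real[OF assms(1,2)] using assms(3) by (intro Inf_lower) blast

lemma symmetry_coeff_real_ge:
  fixes f :: "'a::euclidean_space \<Rightarrow> real"
  assumes "f differentiable_on UNIV" "strictly_convex f"
    and "\<And>x y. x \<noteq> y \<Longrightarrow> r \<le> ereal (breg f x y / breg f y x)"
  shows "r \<le> symmetry_coeff (\<lambda>x. ereal (f x))"
  unfolding symmetry_coeff_real[OF assms(1,2)] using assms(3) by (intro Inf_greatest) blast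

text \<open>
  With \<open>r\<close> the smallest ratio, summing \<open>r b\<^sub>i \<le> a\<^sub>i\<close> gives the claim.
\<close>
lemma ratio_of_sums_ge_some_ratio:
  fixes a b :: "'i \<Rightarrow> real"
  assumes I: "finite I" "I \<noteq> {}" and b: "\<And>i. i \<in> I \<Longrightarrow> b i > 0"
  obtains j where "j \<in> I" "a j / b j \<le> sum a I / sum b I"
proof -
  obtain j where j: "j \<in> I" "\<And>i. i \<in> I \<Longrightarrow> a j / b j \<le> a i / b i"
    using ex_min_if_finite[of "(\<lambda>i. a i / b i) ` I"] I by (force simp: not_less)
  have "a j / b j * b i \<le> a i" if "i \<in> I" for i
    using j(2)[OF that] b[OF that] by (simp add: pos_le_divide_eq)
  then have "a j / b j * sum b I \<le> sum a I"
    unfolding sum_distrib_left by (rule sum_mono)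
  moreover have "sum b I > 0"
    using I b by (intro sum_pos) auto
  ultimately have "a j / b j \<le> sum a I / sum b I"
    by (simp add: pos_le_divide_eq)
  with j(1) that show ?thesis by blast
qed

lemma symmetry_coeff_sum_ge_Min:
  fixes f :: "'i \<Rightarrow> 'a::euclidean_space \<Rightarrow> real"
  assumes I: "finite I" "I \<noteq> {}"
    and diff: "\<And>i. i \<in> I \<Longrightarrow> f i differentiable_on UNIV"
    and conv: "\<And>i. i \<in> I \<Longrightarrow> strictly_convex (f i)"
  shows "Min ((\<lambda>i. symmetry_coeff (\<lambda>x. ereal (f i x))) ` I)
    \<le> symmetry_coeff (\<lambda>x. ereal (\<Sum>i\<in>I. f i x))"
proof (rule symmetry_coeff_real_ge)
  fix x y :: 'a assume "x \<noteq> y"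
  obtain j where j: "j \<in> I"
    "breg (f j) x y / breg (f j) y x \<le> (\<Sum>i\<in>I. breg (f i) x y) / (\<Sum>i\<in>I. breg (f i) y x)"
    by (rule ratio_of_sums_ge_some_ratio[where a = "\<lambda>i. breg (f i) x y"
          and b = "\<lambda>i. breg (f i) y x", OF I])
      (use breg_pos[OF diff conv] \<open>x \<noteq> y\<close> in auto)
  have "Min ((\<lambda>i. symmetry_coeff (\<lambda>x. ereal (f i x))) ` I) \<le> symmetry_coeff (\<lambda>x. ereal (f j x))"
    using I j(1) by (intro Min_le) auto
  also have "\<dots> \<le> ereal (breg (f j) x y / breg (f j) y x)"
    using symmetry_coeff_real_le[OF diff conv \<open>x \<noteq> y\<close>] j(1) by blast
  also have "\<dots> \<le> ereal (breg (\<lambda>x. \<Sum>i\<in>I. f i x) x y / breg (\<lambda>x. \<Sum>i\<in>I. f i x) y x)"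
    using j(2) by (simp add: breg_sum diff)
  finally show "Min ((\<lambda>i. symmetry_coeff (\<lambda>x. ereal (f i x))) ` I)
    \<le> ereal (breg (\<lambda>x. \<Sum>i\<in>I. f i x) x y / breg (\<lambda>x. \<Sum>i\<in>I. f i x) y x)" .
qed (use differentiable_on_strictly_convex_sum[OF I diff conv] in auto)

text \<open>
  Dividing numerator and denominator of the ratio at \<open>(t x, t y)\<close> by the dominant power of \<open>t\<close>
  makes every other term vanish in the limit. The filter stands for \<open>t\<close> tending to \<open>0\<close> or to
  infinity.
\<close>
lemma symmetry_coeff_sum_le_dominant:
  fixes f :: "'i \<Rightarrow> 'a::euclidean_space \<Rightarrow> real"
  assumes I: "finite I" "k \<in> I"
    and diff: "\<And>i. i \<in> I \<Longrightarrow> f i differentiable_on UNIV"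
    and conv: "\<And>i. i \<in> I \<Longrightarrow> strictly_convex (f i)"
    and hom: "\<And>i c x. i \<in> I \<Longrightarrow> c > 0 \<Longrightarrow> f i (c *\<^sub>R x) = c powr p i * f i x"
    and F: "F \<noteq> bot" "\<forall>\<^sub>F t in F. t > 0"
    and dom: "\<And>i. i \<in> I \<Longrightarrow> i \<noteq> k \<Longrightarrow> ((\<lambda>t. t powr (p i - p k)) \<longlongrightarrow> 0) F"
  shows "symmetry_coeff (\<lambda>x. ereal (\<Sum>i\<in>I. f i x)) \<le> symmetry_coeff (\<lambda>x. ereal (f k x))"
proof (rule symmetry_coeff_real_ge)
  fix x y :: 'a assume xy: "x \<noteq> y"
  let ?s = "\<lambda>x. \<Sum>i\<in>I. f i x"
  have ne: "I \<noteq> {}" using I by auto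
  note s = differentiable_on_strictly_convex_sum[OF I(1) ne diff conv, simplified]
  have pos: "breg (f k) y x > 0"
    using breg_pos[OF diff conv] I(2) xy by auto
  let ?q = "\<lambda>x y t. \<Sum>i\<in>I. t powr (p i - p k) * breg (f i) x y"
  have scaled: "breg ?s (t *\<^sub>R x) (t *\<^sub>R y) = t powr p k * ?q x y t" if "t > 0" for x y t
  proof -
    have "breg (f i) (t *\<^sub>R x) (t *\<^sub>R y)
        = t powr p k * (t powr (p i - p k) * breg (f i) x y)" if "i \<in> I" for i
      using breg_homogeneous[OF diff[OF that] \<open>t > 0\<close> hom[OF that]] \<open>t > 0\<close>
      by (simp add: powr_diff)
    then show ?thesis
      by (simp add: breg_sum diff sum_distrib_left)
  qed
  have lim: "(?q x y \<longlongrightarrow> breg (f k) x y) F" for x y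
  proof -
    have "((\<lambda>t. t powr (p i - p k) * breg (f i) x y)
        \<longlongrightarrow> (if i = k then breg (f i) x y else 0)) F" if "i \<in> I" for i
    proof (cases "i = k")
      case True
      \<comment> \<open>The power is \<open>1\<close> only for \<open>t \<noteq> 0\<close>, so the two sides agree eventually, not everywhere.\<close>
      have "\<forall>\<^sub>F t in F. breg (f i) x y = t powr (p i - p k) * breg (f i) x y"
        using F(2) by (rule eventually_mono) (simp add: True)
      from Lim_transform_eventually[OF tendsto_const this] True show ?thesis by simp
    next
      case False
      then show ?thesis
        using tendsto_mult_left_zero[OF dom[OF that False]] by simp
    qed
    then have "(?q x y \<longlongrightarrow> (\<Sum>i\<in>I. if i = k then breg (f i) x y else 0)) F"
      by (rule tendsto_sum)
    then show ?thesis
      using I by simp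
  qed
  have "((\<lambda>t. ereal (?q x y t / ?q y x t)) \<longlongrightarrow> ereal (breg (f k) x y / breg (f k) y x)) F"
    using pos by (intro tendsto_ereal tendsto_divide lim) auto
  moreover have "\<forall>\<^sub>F t in F. symmetry_coeff (\<lambda>x. ereal (?s x)) \<le> ereal (?q x y t / ?q y x t)"
    using F(2)
  proof (rule eventually_mono)
    fix t :: real assume t: "t > 0"
    have "symmetry_coeff (\<lambda>x. ereal (?s x))
        \<le> ereal (breg ?s (t *\<^sub>R x) (t *\<^sub>R y) / breg ?s (t *\<^sub>R y) (t *\<^sub>R x))"
      using s xy t by (intro symmetry_coeff_real_le) auto
    also have "breg ?s (t *\<^sub>R x) (t *\<^sub>R y) / breg ?s (t *\<^sub>R y) (t *\<^sub>R x) = ?q x y t / ?q y x t"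
      unfolding scaled[OF t] using t by simp
    finally show "symmetry_coeff (\<lambda>x. ereal (?s x)) \<le> ereal (?q x y t / ?q y x t)" .
  qed
  ultimately show "symmetry_coeff (\<lambda>x. ereal (?s x)) \<le> ereal (breg (f k) x y / breg (f k) y x)"
    by (rule tendsto_lowerbound) (rule F(1))
qed (use diff conv I in auto)

section \<open>Sums of homogeneous Legendre functions\<close>

theorem proposition3p4:
  fixes m :: nat
    and h :: "nat \<Rightarrow> real ^ 'n \<Rightarrow> ereal"
    and p :: "nat \<Rightarrow> real"
  assumes "m \<ge> 1"
    and "\<And>i. i \<in> {1..m} \<Longrightarrow> legendre (h i)"
    and "\<And>i. i \<in> {1..m} \<Longrightarrow> p i > 1"
    and "\<And>i. i \<in> {1..m} \<Longrightarrow> pos_homogeneous_on (interior (eff_dom (h i))) (p i) (h i)"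
    and "\<And>i. i \<in> {1..<m} \<Longrightarrow> p i \<le> p (i + 1)"
    and "m \<ge> 2 \<Longrightarrow> p 1 < p 2 \<and> p (m - 1) < p m"
  shows "legendre (\<lambda>x. \<Sum>i\<in>{1..m}. h i x) \<and>
    symmetry_coeff (\<lambda>x. \<Sum>i\<in>{1..m}. h i x) \<in>
      {Min ((\<lambda>i. symmetry_coeff (h i)) ` {1..m}) ..
        min (symmetry_coeff (h 1)) (symmetry_coeff (h m))}"
proof -
  let ?I = "{1..m}"
  have I: "finite ?I" "?I \<noteq> {}" "1 \<in> ?I" "m \<in> ?I"
    using assms(1) by auto
  have "\<forall>i\<in>?I. \<exists>f. h i = (\<lambda>x. ereal (f x)) \<and> f differentiable_on UNIV \<and> strictly_convex f \<and>
      (\<forall>c>0. \<forall>x. f (c *\<^sub>R x) = c powr p i * f x)"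
  proof
    fix i assume i: "i \<in> ?I"
    obtain f where "h i = (\<lambda>x. ereal (f x))" "f differentiable_on UNIV" "strictly_convex f"
      "\<And>c x. c > 0 \<Longrightarrow> f (c *\<^sub>R x) = c powr p i * f x"
      using homogeneous_legendre_real[OF assms(2)[OF i] assms(4)[OF i] assms(3)[OF i]] by metis
    then show "\<exists>f. h i = (\<lambda>x. ereal (f x)) \<and> f differentiable_on UNIV \<and> strictly_convex f \<and>
        (\<forall>c>0. \<forall>x. f (c *\<^sub>R x) = c powr p i * f x)"
      by blast
  qed
  then obtain f where f: "\<forall>i\<in>?I. h i = (\<lambda>x. ereal (f i x)) \<and> f i differentiable_on UNIV \<and>
      strictly_convex (f i) \<and> (\<forall>c>0. \<forall>x. f i (c *\<^sub>R x) = c powr p i * f i x)"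
    by (rule bchoice[THEN exE])
  then have h: "h i = (\<lambda>x. ereal (f i x))" and diff: "f i differentiable_on UNIV"
    and conv: "strictly_convex (f i)" and hom: "\<And>c x. c > 0 \<Longrightarrow> f i (c *\<^sub>R x) = c powr p i * f i x"
    if "i \<in> ?I" for i
    using that by blast+
  have sum: "(\<lambda>x. \<Sum>i\<in>?I. h i x) = (\<lambda>x. ereal (\<Sum>i\<in>?I. f i x))"
    by (simp add: h)
  have mono: "p i \<le> p j" if "i \<le> j" "1 \<le> i" "j \<le> m" for i j
    using that
  proof (induction j rule: dec_induct)
    case (step n)
    then show ?case using assms(5)[of n] by simp
  qed simp
  have less: "p 1 < p i" if "i \<in> ?I" "i \<noteq> 1" for i
    using that mono[of 2 i] assms(6) by force
  have greater: "p i < p m" if "i \<in> ?I" "i \<noteq> m" for i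
    using that mono[of i "m - 1"] assms(6) by force
  have "symmetry_coeff (\<lambda>x. ereal (\<Sum>i\<in>?I. f i x)) \<le> symmetry_coeff (\<lambda>x. ereal (f 1 x))"
  proof (rule symmetry_coeff_sum_le_dominant[where f = f and k = 1 and p = p and F = "at_right 0"])
    fix i assume "i \<in> ?I" "i \<noteq> 1"
    then have "p i - p 1 > 0"
      using less by simp
    moreover have "((\<lambda>t::real. t) \<longlongrightarrow> 0) (at_right 0)"
      by (rule tendsto_ident_at)
    moreover have "\<forall>\<^sub>F t in at_right (0::real). t \<ge> 0"
      by (rule eventually_mono[OF eventually_at_right_less]) simp
    ultimately have "((\<lambda>t. t powr (p i - p 1)) \<longlongrightarrow> 0 powr (p i - p 1)) (at_right 0)"
      by (intro tendsto_powr' tendsto_const) auto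
    then show "((\<lambda>t. t powr (p i - p 1)) \<longlongrightarrow> 0) (at_right 0)"
      by simp
  qed (use I diff conv hom in \<open>auto simp: eventually_at_right_less\<close>)
  moreover have "symmetry_coeff (\<lambda>x. ereal (\<Sum>i\<in>?I. f i x)) \<le> symmetry_coeff (\<lambda>x. ereal (f m x))"
  proof (rule symmetry_coeff_sum_le_dominant[where f = f and k = m and p = p and F = at_top])
    fix i assume "i \<in> ?I" "i \<noteq> m"
    then show "((\<lambda>t. t powr (p i - p m)) \<longlongrightarrow> 0) at_top"
      using greater by (intro tendsto_neg_powr filterlim_ident) simp
  qed (use I diff conv hom in \<open>auto simp: eventually_gt_at_top\<close>)
  moreover have "Min ((\<lambda>i. symmetry_coeff (\<lambda>x. ereal (f i x))) ` ?I)
      \<le> symmetry_coeff (\<lambda>x. ereal (\<Sum>i\<in>?I. f i x))"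
    by (rule symmetry_coeff_sum_ge_Min[OF I(1,2) diff conv])
  moreover have "(\<lambda>i. symmetry_coeff (h i)) ` ?I = (\<lambda>i. symmetry_coeff (\<lambda>x. ereal (f i x))) ` ?I"
    by (rule image_cong) (simp_all add: h)
  moreover have "legendre (\<lambda>x. ereal (\<Sum>i\<in>?I. f i x))"
    using differentiable_on_strictly_convex_sum[OF I(1,2) diff conv] by (intro legendre_real) auto
  ultimately show ?thesis
    unfolding sum h[OF I(3)] h[OF I(4)] by simp
qed

end
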